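(* Let $H$ be a real Hilbert space, let $F:H\to H$ be a monotone, twice Fréchet differentiable operator, and let $f_\delta\in H$. Suppose $M_1,c_0$ and $c_1$ are positive constants and $0\neq y\in H$. Then there exist $\lambda>0$ and a function $a\in C^1[0,\infty)$, positive and strictly decreasing with $\lim_{t\to\infty}a(t)=0$, such that the following conditions hold (the second and third for all $t\ge0$): $$\frac{M_1}{\|y\|}\le\lambda,$$ $$\frac{c_0}{a(t)}\le\frac{\lambda}{2a(t)}\left[1-\frac{|\dot a(t)|}{a(t)}\right],$$ $$c_1\frac{|\dot a(t)|}{a(t)}\le\frac{a(t)}{2\lambda}\left[1-\frac{|\dot a(t)|}{a(t)}\right],$$ $$\|F(0)-f_\delta\|\le\frac{a^2(0)}{\lambda}.$$
   Context: Monotone means $\langle F(u)-F(v),u-v\rangle\ge0$ for all $u,v\in H$. The dot denotes $d/dt$. Here $\delta$ and $f_\delta$ are fixed. *)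

theory Defs
  imports "HOL-Analysis.Analysis"
begin

definition monotone_operator :: "('h::real_inner \<Rightarrow> 'h) \<Rightarrow> bool" where
  "monotone_operator F \<longleftrightarrow> (\<forall>u v. inner (F u - F v) (u - v) \<ge> 0)"

(* The Frechet derivative is a map into the space of bounded linear operators with the
   operator norm; twice differentiable means that this map is again Frechet differentiable
   everywhere. No continuity of the second derivative is required. *)
definition twice_frechet_differentiable ::
    "('a::real_normed_vector \<Rightarrow> 'b::real_normed_vector) \<Rightarrow> bool" where
  "twice_frechet_differentiable F \<longleftrightarrow>
     (\<exists>F' :: 'a \<Rightarrow> 'a \<Rightarrow>\<^sub>L 'b.
        (\<forall>x. (F has_derivative blinfun_apply (F' x)) (at x)) \<and>
        (\<forall>x. F' differentiable (at x)))"

(* a is in C^1[0,infinity) with derivative a'. The derivative at 0 is one-sided, whereas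
   C1_differentiable_on would involve the values of a at negative arguments. *)
definition C1_halfline :: "(real \<Rightarrow> real) \<Rightarrow> (real \<Rightarrow> real) \<Rightarrow> bool" where
  "C1_halfline a a' \<longleftrightarrow>
     (\<forall>t\<ge>0. (a has_real_derivative a' t) (at t within {0..})) \<and> continuous_on {0..} a'"

end

theory Submission
  imports Defs
begin

text \<open>
  Take \<open>a t = d / (t + 2)\<close>, so that \<open>\<bar>a' t\<bar> / a t = 1 / (t + 2) \<le> 1 / 2\<close>. The bracket
  \<open>1 - \<bar>a' t\<bar> / a t\<close> is then at least \<open>1 / 2\<close>, and the four conditions reduce to
  \<open>M\<^sub>1 / \<parallel>y\<parallel> \<le> l\<close>, \<open>4 c\<^sub>0 \<le> l\<close>, \<open>4 l c\<^sub>1 \<le> d\<close> and \<open>4 l \<parallel>F 0 - f\<^sub>\<delta>\<parallel> \<le> d\<^sup>2\<close>,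
  which hold once \<open>l\<close>, and then \<open>d\<close>, is large enough.
\<close>

theorem lemma2p7:
  fixes F :: "'h::{real_inner, complete_space} \<Rightarrow> 'h"
    and f\<^sub>\<delta> y :: 'h
    and M\<^sub>1 c\<^sub>0 c\<^sub>1 :: real
  assumes "monotone_operator F"
    and "twice_frechet_differentiable F"
    and "M\<^sub>1 > 0" and "c\<^sub>0 > 0" and "c\<^sub>1 > 0"
    and "y \<noteq> 0"
  shows "\<exists>(l::real) (a :: real \<Rightarrow> real) (a' :: real \<Rightarrow> real).
      l > 0 \<and>
      C1_halfline a a' \<and>
      (\<forall>t\<ge>0. a t > 0) \<and>
      strict_antimono_on {0..} a \<and>
      (a \<longlongrightarrow> 0) at_top \<and>
      M\<^sub>1 / norm y \<le> l \<and>
      (\<forall>t\<ge>0. c\<^sub>0 / a t \<le> l / (2 * a t) * (1 - \<bar>a' t\<bar> / a t)) \<and>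
      (\<forall>t\<ge>0. c\<^sub>1 * (\<bar>a' t\<bar> / a t) \<le> a t / (2 * l) * (1 - \<bar>a' t\<bar> / a t)) \<and>
      norm (F 0 - f\<^sub>\<delta>) \<le> (a 0)\<^sup>2 / l"
proof -
  define N where "N = norm (F 0 - f\<^sub>\<delta>)"
  \<comment> \<open>The final \<open>1\<close> gives \<open>l \<ge> 1\<close>, which yields
    \<open>N \<le> d\<close> below.\<close>
  define l where "l = 4 * c\<^sub>0 + M\<^sub>1 / norm y + 1"
  \<comment> \<open>The last factor is at least each of \<open>c\<^sub>1\<close>, \<open>N\<close>
    and \<open>1\<close>, so \<open>d\<close> dominates \<open>4 * l * c\<^sub>1\<close>,
    \<open>N\<close> and \<open>4 * l\<close>.\<close>
  define d where "d = 4 * l * (c\<^sub>1 + N + 1)"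
  \<comment> \<open>With \<open>t + 1\<close> in the denominator the bracket would vanish at
    \<open>t = 0\<close>.\<close>
  define a where "a t = d / (t + 2)" for t :: real
  define a' where "a' t = - d / (t + 2)\<^sup>2" for t :: real
  have N: "N \<ge> 0" by (simp add: N_def)
  have y: "M\<^sub>1 / norm y \<ge> 0" using assms by simp
  have l: "l \<ge> 1" "4 * c\<^sub>0 \<le> l" "M\<^sub>1 / norm y \<le> l"
    using y \<open>c\<^sub>0 > 0\<close> by (auto simp: l_def)
  have d: "d > 0" using l N \<open>c\<^sub>1 > 0\<close> by (simp add: d_def)
  have c1_le: "4 * l * c\<^sub>1 \<le> d" using l N by (simp add: d_def mult_left_mono)
  have N_le: "4 * l * N \<le> d\<^sup>2"
  proof -
    \<comment> \<open>In \<open>d\<^sup>2\<close>, one factor \<open>d\<close> absorbs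
      \<open>4 * l\<close> and the other absorbs \<open>N\<close>.\<close>
    have dN: "N \<le> d" and dl: "4 * l \<le> d"
      using l N \<open>c\<^sub>1 > 0\<close> mult_mono[of 1 "4 * l" N "c\<^sub>1 + N + 1"]
        mult_left_mono[of 1 "c\<^sub>1 + N + 1" "4 * l"] by (auto simp: d_def)
    show ?thesis using mult_mono[OF dl dN] d N by (simp add: power2_eq_square)
  qed
  have a_pos: "a t > 0" if "t \<ge> 0" for t using d that by (simp add: a_def)
  have ratio: "\<bar>a' t\<bar> / a t = 1 / (t + 2)" if "t \<ge> 0" for t
    using d that by (simp add: a_def a'_def power2_eq_square)
  have bracket: "1 - \<bar>a' t\<bar> / a t \<ge> 1 / 2" if "t \<ge> 0" for t
    using that by (simp add: ratio field_simps)
  have "C1_halfline a a'"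
    unfolding C1_halfline_def a_def a'_def
    by (auto intro!: derivative_eq_intros continuous_intros simp: power2_eq_square)
  moreover have "strict_antimono_on {0..} a"
    using d by (auto intro!: monotone_onI divide_strict_left_mono simp: a_def)
  moreover have "(a \<longlongrightarrow> 0) at_top"
    \<comment> \<open>The constant is moved to the left to match
      \<open>filterlim_tendsto_add_at_top\<close>.\<close>
    unfolding a_def add.commute[of _ 2]
    by (rule tendsto_divide_0[OF tendsto_const filterlim_at_top_imp_at_infinity,
          OF filterlim_tendsto_add_at_top[OF tendsto_const filterlim_ident]])
  moreover have "c\<^sub>0 / a t \<le> l / (2 * a t) * (1 - \<bar>a' t\<bar> / a t)" if "t \<ge> 0" for t
  proof -
    have "c\<^sub>0 / a t \<le> l / (2 * a t) * (1 / 2)"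
      using l a_pos[OF that] by (simp add: field_simps)
    also have "\<dots> \<le> l / (2 * a t) * (1 - \<bar>a' t\<bar> / a t)"
      using l a_pos[OF that] by (intro mult_left_mono bracket that) auto
    finally show ?thesis .
  qed
  moreover have "c\<^sub>1 * (\<bar>a' t\<bar> / a t) \<le> a t / (2 * l) * (1 - \<bar>a' t\<bar> / a t)" if "t \<ge> 0" for t
  proof -
    have "c\<^sub>1 * (\<bar>a' t\<bar> / a t) = c\<^sub>1 / (t + 2)"
      by (simp add: ratio[OF that])
    \<comment> \<open>In \<open>4 * l\<close>, one factor 2 comes from \<open>2 * l\<close> in the
      goal, the other from the lower bound \<open>1 / 2\<close> of the bracket.\<close>
    also have "\<dots> \<le> d / (4 * l) / (t + 2)"
      using c1_le l that by (intro divide_right_mono) (auto simp: field_simps)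
    also have "\<dots> = a t / (2 * l) * (1 / 2)"
      by (simp add: a_def)
    also have "\<dots> \<le> a t / (2 * l) * (1 - \<bar>a' t\<bar> / a t)"
      using l a_pos[OF that] by (intro mult_left_mono bracket that) auto
    finally show ?thesis .
  qed
  \<comment> \<open>Since \<open>a 0 = d / 2\<close>, the right side is
    \<open>d\<^sup>2 / (4 * l)\<close>; hence the 4 in \<open>N_le\<close>.\<close>
  moreover have "norm (F 0 - f\<^sub>\<delta>) \<le> (a 0)\<^sup>2 / l"
    using N_le l by (simp add: a_def N_def[symmetric] field_simps)
  ultimately show ?thesis
    using l a_pos by (intro exI[of _ l] exI[of _ a] exI[of _ a']) auto
qed

end
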